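(* Let $f(x)=x^x$. Then $f$ has the series expansion $$f(x)=f(a)\sum_{k=0}^{\infty}\frac{(x-a)^k}{k!}\sum_{i=0}^{k}\Delta_i^{(k)}(a)\,\ln^{k-i}(a),\qquad a\in\mathbb{R}.$$ In the particular case $a=1$ this reads $$f(x)=\sum_{k=0}^{\infty}\frac{(x-1)^k}{k!}\,\Delta_k^{(k)}(1).$$
   Context: The integers $\Omega(a,b)$, for $a\in\mathbb{Z}_{>0}$ and $b\in\mathbb{Z}_{\ge 0}$, are defined recursively by: $\Omega(a,0)=1$; $\Omega(a,b)=0$ if $b\ge a$ and $b\ge 1$; $\Omega(a,1)=\Omega(a-1,1)+1$ for $a\ge 2$; and $\Omega(a,b)=\Omega(a-1,b)-(b-1)\,\Omega(a-1,b-1)$ for $2\le b\le a-1$. For $n,k\in\mathbb{Z}_{\ge 0}$, the functions $\Delta_k^{(n)}(x)$ are defined recursively by: $\Delta_0^{(n)}(x)=1$; for $k=1,\dots,n$, $$\Delta_k^{(n)}(x)=\Delta_k^{(n-1)}(x)+\sum_{i=0}^{k-1}\Omega(n,i)\frac{1}{x^i}\Delta_{k-1-i}^{(n-1-i)}(x);$$ and $\Delta_k^{(n)}(x)=0$ if $k>n$. The superscript $(n)$ is an index, not a derivative, and $\ln^{m}(a)$ denotes the power $(\ln a)^m$.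
   Formalization: The expansion is stated for real a ≠ 0, since ln(a) and 1/a^i are undefined at a = 0, and for real x with |x − a| < |a|, since the series diverges for example at a = 1, x = 3; for a < 0, ln and x^x are taken with the principal complex logarithm. *)

theory Defs
  imports "HOL-Analysis.Analysis"
begin

text \<open>
  Only the values \<open>Omega a b\<close> with \<open>a > 0\<close> are meaningful; the clauses below also assign
  (irrelevant) values for \<open>a = 0\<close>.
\<close>

function Omega :: "nat \<Rightarrow> nat \<Rightarrow> int" where
  "Omega a b =
     (if b = 0 then 1
      else if b \<ge> a then 0
      else if b = 1 then Omega (a - 1) 1 + 1
      else Omega (a - 1) b - int (b - 1) * Omega (a - 1) (b - 1))"
  by pat_completeness auto
termination by (relation "Wellfounded.measure fst") auto

declare Omega.simps [simp del]

text \<open>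
  \<open>Delta n k x\<close> is \<open>\<Delta>\<^sub>k\<close> with upper index \<open>n\<close>, evaluated at \<open>x\<close>. It is a polynomial in \<open>1/x\<close>
  with integer coefficients, so it is defined over any field. In the recursive clause
  \<open>i < k \<le> n\<close>, hence none of the natural-number subtractions truncates.
\<close>

function Delta :: "nat \<Rightarrow> nat \<Rightarrow> 'a::field \<Rightarrow> 'a" where
  "Delta n k x =
     (if k = 0 then 1
      else if k > n then 0
      else Delta (n - 1) k x +
           (\<Sum>i=0..k-1. of_int (Omega n i) * (1 / x ^ i) * Delta (n - 1 - i) (k - 1 - i) x))"
  by pat_completeness auto
termination by (relation "Wellfounded.measure fst") auto

declare Delta.simps [simp del]

end

theory Submission
  imports Defs "HOL-Complex_Analysis.Complex_Analysis"
begin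

text \<open>
  If \<open>L\<close> is a branch of the logarithm, then \<open>f z = exp (z * L z)\<close> satisfies
  \<open>f' = (L + 1) * f\<close>. Differentiating this \<open>n\<close> times with the Leibniz rule expresses
  the derivative of order \<open>n + 1\<close> by the lower ones, with coefficients \<open>n choose i\<close> times
  derivatives of \<open>L + 1\<close>. For \<open>i \<ge> 1\<close> the \<open>i\<close>-th derivative of \<open>L + 1\<close> at \<open>z\<close> is
  \<open>(-1)^(i-1) * (i-1)! / z^i\<close>, and its product with \<open>n choose i\<close> is
  \<open>Omega (n + 1) i / z^i\<close> (\<open>Omega_Suc_Suc\<close>). So the quotients \<open>(deriv ^^ n) f z / f z\<close>
  obey a recursion in \<open>n\<close> (\<open>Delta_poly_Suc\<close>); sorted by powers of \<open>L z\<close>, it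
  becomes the recursion that defines \<^const>\<open>Delta\<close>. Hence the series of the theorem is the
  Taylor series of \<open>f\<close>.

  As \<open>f\<close> is holomorphic wherever \<open>L\<close> is, its Taylor series at \<open>a\<close> converges on the ball of
  radius \<open>\<bar>a\<bar>\<close>, provided that a branch exists on the whole ball. For \<open>a > 0\<close> the principal branch
  serves. For \<open>a < 0\<close> the principal branch has its cut along the diameter on which the expansion
  is claimed; but the branch \<open>Ln (- z) + \<i> * pi\<close> is holomorphic on the left half plane and
  agrees with the principal value on the negative real axis, where alone it is compared.
\<close>

section \<open>The coefficients\<close>

lemma Omega_Suc_Suc: "Omega (Suc n) (Suc i) = (-1) ^ i * fact i * int (n choose Suc i)"
proof (induction n arbitrary: i)
  case 0
  show ?case by (simp add: Omega.simps[of "Suc 0"])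
next
  case (Suc n)
  show ?case
  proof (cases i)
    case 0
    then show ?thesis
      using Suc.IH[of 0] by (subst Omega.simps) auto
  next
    case (Suc j)
    show ?thesis
    proof (cases "Suc i \<ge> Suc (Suc n)")
      case True
      then show ?thesis by (subst Omega.simps) (simp add: binomial_eq_0)
    next
      case False
      then have "Omega (Suc (Suc n)) (Suc i) =
          Omega (Suc n) (Suc i) - int i * Omega (Suc n) (Suc j)"
        using Suc by (subst Omega.simps) simp
      also have "\<dots> = (-1) ^ i * fact i * int (Suc n choose Suc i)"
        unfolding Suc.IH using Suc by (simp add: algebra_simps)
      finally show ?thesis .
    qed
  qed
qed

text \<open>
  The polynomial in the value \<open>L\<close> of the logarithm at \<open>x\<close> that multiplies \<open>f x\<close> in the \<open>n\<close>-th
  derivative of \<open>f\<close>. Keeping \<open>L\<close> a separate argument lets one recursion serve every branch.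
\<close>

definition Delta_poly :: "nat \<Rightarrow> 'a::field \<Rightarrow> 'a \<Rightarrow> 'a" where
  "Delta_poly n x L = (\<Sum>k\<le>n. Delta n k x * L ^ (n - k))"

lemma Delta_poly_0 [simp]: "Delta_poly 0 x L = 1"
  by (simp add: Delta_poly_def Delta.simps)

text \<open>
  The power of \<open>L\<close> attached to \<open>Delta n k x\<close> is \<open>n - k\<close>. In the recursion for \<open>Delta n k\<close>
  the terms \<open>Delta (n - 1 - i) (k - 1 - i)\<close> keep this difference, whereas \<open>Delta (n - 1) k\<close>
  lowers it by one: summed over \<open>k\<close>, the former give the polynomials of index \<open>n - 1 - i\<close>, the
  latter \<open>L\<close> times that of index \<open>n - 1\<close>.
\<close>

lemma Delta_poly_Suc:
  "Delta_poly (Suc n) x L =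
     L * Delta_poly n x L + (\<Sum>i\<le>n. of_int (Omega (Suc n) i) / x ^ i * Delta_poly (n - i) x L)"
proof -
  define c where "c i = of_int (Omega (Suc n) i) / x ^ i" for i
  have top: "Delta n (Suc n) x = 0"
    by (subst Delta.simps) simp
  have zero: "Delta m 0 x = 1" for m
    by (subst Delta.simps) simp
  have step: "Delta (Suc n) (Suc k) x =
      Delta n (Suc k) x + (\<Sum>i\<le>k. c i * Delta (n - i) (k - i) x)" if "k \<le> n" for k
    using that by (subst Delta.simps) (simp add: c_def atLeast0AtMost)
  have "Delta_poly (Suc n) x L =
      L ^ Suc n + (\<Sum>k\<le>n. Delta (Suc n) (Suc k) x * L ^ (n - k))"
    unfolding Delta_poly_def by (subst sum.atMost_Suc_shift) (simp add: zero)
  also have "(\<Sum>k\<le>n. Delta (Suc n) (Suc k) x * L ^ (n - k)) =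
      (\<Sum>k\<le>n. Delta n (Suc k) x * L ^ (n - k)) +
      (\<Sum>k\<le>n. \<Sum>i\<le>k. c i * Delta (n - i) (k - i) x * L ^ (n - k))"
    by (simp add: step distrib_right sum.distrib sum_distrib_right)
  also have "L ^ Suc n + ((\<Sum>k\<le>n. Delta n (Suc k) x * L ^ (n - k)) +
      (\<Sum>k\<le>n. \<Sum>i\<le>k. c i * Delta (n - i) (k - i) x * L ^ (n - k))) =
      (\<Sum>k\<le>Suc n. Delta n k x * L ^ (Suc n - k)) +
      (\<Sum>k\<le>n. \<Sum>i\<le>k. c i * Delta (n - i) (k - i) x * L ^ (n - k))"
    by (simp add: sum.atMost_Suc_shift zero del: sum.atMost_Suc)
  also have "(\<Sum>k\<le>Suc n. Delta n k x * L ^ (Suc n - k)) = L * Delta_poly n x L"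
    by (simp add: Delta_poly_def top Suc_diff_le sum_distrib_left mult_ac)
  also have "(\<Sum>k\<le>n. \<Sum>i\<le>k. c i * Delta (n - i) (k - i) x * L ^ (n - k)) =
      (\<Sum>k\<le>n. \<Sum>i\<le>k. c i * Delta (n - i) (k - i) x * L ^ (n - i - (k - i)))"
    by (intro sum.cong refl) auto
  also have "\<dots> = (\<Sum>(i, j)\<in>{(i, j). i + j \<le> n}. c i * Delta (n - i) j x * L ^ (n - i - j))"
    by (subst sum.triangle_reindex_eq) simp
  also have "{(i, j). i + j \<le> n} = Sigma {..n} (\<lambda>i. {..n - i})"
    by auto
  also have "(\<Sum>(i, j)\<in>Sigma {..n} (\<lambda>i. {..n - i}). c i * Delta (n - i) j x * L ^ (n - i - j)) =
      (\<Sum>i\<le>n. c i * Delta_poly (n - i) x L)"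
    by (subst sum.Sigma[symmetric]) (auto simp: Delta_poly_def sum_distrib_left mult_ac)
  finally show ?thesis
    by (simp add: c_def)
qed

lemma Delta_of_real: "Delta n k (of_real x :: 'a::real_field) = of_real (Delta n k x)"
proof (induction n arbitrary: k rule: less_induct)
  case (less n)
  have IH: "Delta (n - Suc i) k' (of_real x :: 'a) = of_real (Delta (n - Suc i) k' x)"
    if "n > 0" for i k'
    using that by (intro less) simp
  show ?case
    using IH[of 0] IH
    by (subst (1 2) Delta.simps) simp
qed

section \<open>Higher derivatives\<close>

text \<open>A function with derivative \<open>1 / z\<close> is a branch of the logarithm up to a constant.\<close>

lemma higher_deriv_log_branch:
  fixes L :: "complex \<Rightarrow> complex"
  assumes "open S" and "0 \<notin> S"
    and L: "\<And>z. z \<in> S \<Longrightarrow> (L has_field_derivative 1 / z) (at z)"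
    and "z \<in> S"
  shows "(deriv ^^ Suc i) (\<lambda>w. L w + 1) z = (-1) ^ i * fact i / z ^ Suc i"
  using \<open>z \<in> S\<close>
proof (induction i arbitrary: z)
  case 0
  have "((\<lambda>w. L w + 1) has_field_derivative 1 / z) (at z)"
    using L[OF 0] by (auto intro!: derivative_eq_intros)
  then show ?case by (simp add: DERIV_imp_deriv)
next
  case (Suc i)
  have "z \<noteq> 0" using Suc.prems \<open>0 \<notin> S\<close> by auto
  have "((\<lambda>w. w ^ Suc i) has_field_derivative of_nat (Suc i) * z ^ i) (at z)"
    using DERIV_power_Suc[OF DERIV_ident, of i z UNIV] by simp
  from DERIV_divide[OF DERIV_const this, of "(-1) ^ i * fact i"]
  have "((\<lambda>w. (-1) ^ i * fact i / w ^ Suc i) has_field_derivative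
      (-1) ^ Suc i * fact (Suc i) / z ^ Suc (Suc i)) (at z)"
    by (rule DERIV_cong) (use \<open>z \<noteq> 0\<close> in \<open>simp_all add: field_simps\<close>)
  then have "((deriv ^^ Suc i) (\<lambda>w. L w + 1) has_field_derivative
      (-1) ^ Suc i * fact (Suc i) / z ^ Suc (Suc i)) (at z)"
    by (rule has_field_derivative_transform_within_open[OF _ \<open>open S\<close> Suc.prems])
       (simp only: Suc.IH)
  then show ?case
    by (subst funpow.simps) (simp only: o_apply DERIV_imp_deriv)
qed

lemma higher_deriv_exp_log:
  fixes L :: "complex \<Rightarrow> complex"
  assumes "open S" and "0 \<notin> S"
    and L: "\<And>z. z \<in> S \<Longrightarrow> (L has_field_derivative 1 / z) (at z)"
    and "z \<in> S"
  shows "(deriv ^^ n) (\<lambda>w. exp (w * L w)) z = exp (z * L z) * Delta_poly n z (L z)"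
  using \<open>z \<in> S\<close>
proof (induction n arbitrary: z rule: less_induct)
  case (less n)
  define f where "f = (\<lambda>w. exp (w * L w))"
  define g where "g = (\<lambda>w. L w + 1)"
  have f': "(f has_field_derivative g w * f w) (at w)" if "w \<in> S" for w
    using L[OF that] that \<open>0 \<notin> S\<close> unfolding f_def g_def
    by (auto intro!: derivative_eq_intros simp: field_simps)
  have holf: "f holomorphic_on S"
    using f' \<open>open S\<close> by (auto simp: holomorphic_on_open)
  have holg: "g holomorphic_on S"
    using L \<open>open S\<close> unfolding g_def
    by (auto simp: holomorphic_on_open intro!: derivative_eq_intros exI)
  show ?case
  proof (cases n)
    case 0
    then show ?thesis by simp
  next
    case (Suc m)
    \<comment> \<open>The factor \<open>L + 1\<close> itself, at \<open>i = 0\<close>, is \<open>L\<close> plus \<open>Omega (Suc m) 0 = 1\<close>.\<close>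
    have coeff: "of_nat (m choose i) * (deriv ^^ i) g z =
        (if i = 0 then L z else 0) + of_int (Omega (Suc m) i) / z ^ i" for i
    proof (cases i)
      case 0
      then show ?thesis by (simp add: g_def Omega.simps)
    next
      case (Suc j)
      then show ?thesis
        using higher_deriv_log_branch[OF \<open>open S\<close> \<open>0 \<notin> S\<close> L less.prems, of j]
        by (simp add: g_def Omega_Suc_Suc del: funpow.simps)
    qed
    have "(deriv ^^ n) f z = (deriv ^^ m) (deriv f) z"
      unfolding Suc by (simp add: funpow_swap1)
    also have "\<dots> = (deriv ^^ m) (\<lambda>w. g w * f w) z"
      using holf holg \<open>open S\<close> less.prems
      by (intro higher_deriv_transform_within_open[of _ S])
         (auto intro!: holomorphic_deriv holomorphic_intros DERIV_imp_deriv f')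
    also have "\<dots> = (\<Sum>i\<le>m. of_nat (m choose i) * (deriv ^^ i) g z * (deriv ^^ (m - i)) f z)"
      unfolding atLeast0AtMost[symmetric]
      by (rule higher_deriv_mult[OF holg holf \<open>open S\<close> less.prems])
    also have "\<dots> = (\<Sum>i\<le>m. ((if i = 0 then L z else 0) + of_int (Omega (Suc m) i) / z ^ i) *
        (f z * Delta_poly (m - i) z (L z)))"
      using less.IH less.prems by (intro sum.cong refl) (simp add: coeff f_def Suc)
    also have "\<dots> = (\<Sum>i\<le>m. if i = 0 then L z * (f z * Delta_poly m z (L z)) else 0) +
        f z * (\<Sum>i\<le>m. of_int (Omega (Suc m) i) / z ^ i * Delta_poly (m - i) z (L z))"
      unfolding sum_distrib_left sum.distrib[symmetric]
      by (intro sum.cong refl) (simp add: algebra_simps)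
    also have "\<dots> = f z * Delta_poly n z (L z)"
      by (simp add: Suc Delta_poly_Suc distrib_left mult_ac)
    finally show ?thesis by (simp add: f_def)
  qed
qed

section \<open>The expansions\<close>

lemma exp_log_power_series:
  fixes L :: "complex \<Rightarrow> complex"
  assumes "0 \<notin> ball a r"
    and L: "\<And>z. z \<in> ball a r \<Longrightarrow> (L has_field_derivative 1 / z) (at z)"
    and z: "z \<in> ball a r"
  shows "(\<lambda>k. (z - a) ^ k / fact k * Delta_poly k a (L a)) sums (exp (z * L z) / exp (a * L a))"
proof -
  have a: "a \<in> ball a r"
    using z by (auto intro: le_less_trans[OF zero_le_dist])
  have "L holomorphic_on ball a r"
    unfolding holomorphic_on_open[OF open_ball] using L by blast
  then have "(\<lambda>w. exp (w * L w)) holomorphic_on ball a r"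
    by (intro holomorphic_intros)
  from sums_divide[OF holomorphic_power_series[OF this z], of "exp (a * L a)"]
  moreover have "(deriv ^^ k) (\<lambda>w. exp (w * L w)) a = exp (a * L a) * Delta_poly k a (L a)" for k
    using assms(1) L a by (intro higher_deriv_exp_log[of "ball a r"]) auto
  ultimately show ?thesis
    by (simp add: mult_ac)
qed

lemma powr_self_sums_complex_pos:
  assumes "a > 0" and "\<bar>x - a\<bar> < a"
  defines "A \<equiv> complex_of_real a" and "X \<equiv> complex_of_real x"
  shows "(\<lambda>k. (X - A) ^ k / fact k * Delta_poly k A (Ln A)) sums (X powr X / A powr A)"
proof -
  have ball: "Re z > 0" if "z \<in> ball A a" for z
    using assms(1) that abs_Re_le_cmod[of "A - z"] by (auto simp: A_def dist_norm)
  have X: "X \<in> ball A a"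
    using assms(2) unfolding A_def X_def by (simp add: dist_of_real dist_real_def abs_minus_commute)
  have "(Ln has_field_derivative 1 / z) (at z)" if "z \<in> ball A a" for z
    using ball[OF that] by (auto intro!: derivative_eq_intros simp: complex_nonpos_Reals_iff divide_inverse)
  moreover have "0 \<notin> ball A a"
    using ball by fastforce
  ultimately have "(\<lambda>k. (X - A) ^ k / fact k * Delta_poly k A (Ln A)) sums
      (exp (X * Ln X) / exp (A * Ln A))"
    using X by (intro exp_log_power_series)
  moreover have "A \<noteq> 0" "X \<noteq> 0"
    using assms by (auto simp: A_def X_def)
  ultimately show ?thesis
    by (simp add: powr_def)
qed

text \<open>
  The principal logarithm is discontinuous on the diameter of the ball. Its values there have
  imaginary part \<open>\<pi>\<close>, so they extend holomorphically as \<open>Ln (- z) + \<i> * \<pi>\<close>.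
\<close>

lemma powr_self_sums_complex_neg:
  assumes "a < 0" and "\<bar>x - a\<bar> < \<bar>a\<bar>"
  defines "A \<equiv> complex_of_real a" and "X \<equiv> complex_of_real x"
  shows "(\<lambda>k. (X - A) ^ k / fact k * Delta_poly k A (Ln A)) sums (X powr X / A powr A)"
proof -
  define L where "L z = Ln (- z) + \<i> * pi" for z
  have L_eq: "L (complex_of_real t) = Ln (complex_of_real t)" if "t < 0" for t
    using that Ln_of_real'[of t] Ln_of_real[of "- t"] by (simp add: L_def mult.commute)
  have ball: "Re z < 0" if "z \<in> ball A \<bar>a\<bar>" for z
    using assms(1) that abs_Re_le_cmod[of "A - z"] by (auto simp: A_def dist_norm)
  have X: "X \<in> ball A \<bar>a\<bar>"
    using assms(2) unfolding A_def X_def by (simp add: dist_of_real dist_real_def abs_minus_commute)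
  have "(L has_field_derivative 1 / z) (at z)" if "z \<in> ball A \<bar>a\<bar>" for z
    using ball[OF that] unfolding L_def
    by (auto intro!: derivative_eq_intros simp: complex_nonpos_Reals_iff divide_inverse)
  moreover have "0 \<notin> ball A \<bar>a\<bar>"
    using ball by fastforce
  ultimately have "(\<lambda>k. (X - A) ^ k / fact k * Delta_poly k A (L A)) sums
      (exp (X * L X) / exp (A * L A))"
    using X by (intro exp_log_power_series)
  moreover have "L A = Ln A" "L X = Ln X"
    using assms by (auto simp: A_def X_def intro!: L_eq)
  moreover have "A \<noteq> 0" "X \<noteq> 0"
    using assms by (auto simp: A_def X_def)
  ultimately show ?thesis
    by (simp add: powr_def)
qed

lemma powr_self_sums_real:
  fixes a x :: real
  assumes "a > 0" and "\<bar>x - a\<bar> < a"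
  shows "(\<lambda>k. (x - a) ^ k / fact k * Delta_poly k a (ln a)) sums (x powr x / a powr a)"
proof -
  have "x > 0" using assms by linarith
  have "complex_of_real (Delta_poly k a (ln a)) = Delta_poly k (of_real a) (Ln (of_real a))" for k
    using assms by (simp add: Delta_poly_def Delta_of_real Ln_of_real)
  then have "(\<lambda>k. complex_of_real ((x - a) ^ k / fact k * Delta_poly k a (ln a))) sums
      complex_of_real (x powr x / a powr a)"
    using powr_self_sums_complex_pos[OF assms] \<open>x > 0\<close> \<open>a > 0\<close> by (simp add: powr_of_real)
  then show ?thesis
    by (simp only: sums_of_real_iff)
qed

theorem mainTheorem1:
  "(\<forall>a x :: real. a > 0 \<and> \<bar>x - a\<bar> < a \<longrightarrow>
       summable (\<lambda>k. (x - a) ^ k / fact k * (\<Sum>i=0..k. Delta k i a * ln a ^ (k - i))) \<and>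
       x powr x =
         a powr a * (\<Sum>k. (x - a) ^ k / fact k * (\<Sum>i=0..k. Delta k i a * ln a ^ (k - i))))
   \<and>
   (\<forall>a x :: real. a < 0 \<and> \<bar>x - a\<bar> < \<bar>a\<bar> \<longrightarrow>
       (let A = complex_of_real a; X = complex_of_real x in
        summable (\<lambda>k. (X - A) ^ k / fact k * (\<Sum>i=0..k. Delta k i A * Ln A ^ (k - i))) \<and>
        X powr X =
          A powr A * (\<Sum>k. (X - A) ^ k / fact k * (\<Sum>i=0..k. Delta k i A * Ln A ^ (k - i)))))
   \<and>
   (\<forall>x :: real. \<bar>x - 1\<bar> < 1 \<longrightarrow>
       summable (\<lambda>k. (x - 1) ^ k / fact k * Delta k k 1) \<and>
       x powr x = (\<Sum>k. (x - 1) ^ k / fact k * Delta k k 1))"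
proof (intro conjI allI impI)
  fix a x :: real
  assume "a > 0 \<and> \<bar>x - a\<bar> < a"
  then have "(\<lambda>k. (x - a) ^ k / fact k * (\<Sum>i=0..k. Delta k i a * ln a ^ (k - i))) sums
      (x powr x / a powr a)" and "a powr a \<noteq> 0"
    using powr_self_sums_real[of a x] by (auto simp: Delta_poly_def atLeast0AtMost)
  then show "summable (\<lambda>k. (x - a) ^ k / fact k * (\<Sum>i=0..k. Delta k i a * ln a ^ (k - i)))"
    and "x powr x =
      a powr a * (\<Sum>k. (x - a) ^ k / fact k * (\<Sum>i=0..k. Delta k i a * ln a ^ (k - i)))"
    by (auto dest: sums_summable sums_unique[symmetric])
next
  fix a x :: real
  assume "a < 0 \<and> \<bar>x - a\<bar> < \<bar>a\<bar>"
  moreover define A X where "A = complex_of_real a" and "X = complex_of_real x"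
  ultimately have "(\<lambda>k. (X - A) ^ k / fact k * (\<Sum>i=0..k. Delta k i A * Ln A ^ (k - i))) sums
      (X powr X / A powr A)" and "A powr A \<noteq> 0"
    using powr_self_sums_complex_neg[of a x] by (auto simp: Delta_poly_def atLeast0AtMost)
  then show "let A = complex_of_real a; X = complex_of_real x in
        summable (\<lambda>k. (X - A) ^ k / fact k * (\<Sum>i=0..k. Delta k i A * Ln A ^ (k - i))) \<and>
        X powr X =
          A powr A * (\<Sum>k. (X - A) ^ k / fact k * (\<Sum>i=0..k. Delta k i A * Ln A ^ (k - i)))"
    unfolding Let_def A_def [symmetric] X_def [symmetric]
    by (auto dest: sums_summable sums_unique[symmetric])
next
  fix x :: real
  assume "\<bar>x - 1\<bar> < 1"
  \<comment> \<open>As \<open>ln 1 = 0\<close>, only the constant term of the polynomial in the logarithm survives.\<close>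
  moreover have "Delta_poly k (1::real) (ln 1) = Delta k k 1" for k
  proof -
    have "Delta_poly k (1::real) (ln 1) = (\<Sum>i\<le>k. if i = k then Delta k i 1 else 0)"
      unfolding Delta_poly_def by (intro sum.cong refl) (auto simp: power_0_left)
    then show ?thesis by simp
  qed
  ultimately have "(\<lambda>k. (x - 1) ^ k / fact k * Delta k k 1) sums (x powr x)"
    using powr_self_sums_real[of 1 x] by simp
  then show "summable (\<lambda>k. (x - 1) ^ k / fact k * Delta k k 1)"
    and "x powr x = (\<Sum>k. (x - 1) ^ k / fact k * Delta k k 1)"
    by (auto dest: sums_summable sums_unique)
qed

end
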